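(* Let $G$ be a group of nilpotency class two generated by abelian subgroups $X$ and $Y$. Assume that there exists an associative ring $A$ with $1$ such that $G$ is a Noetherian $A$-group. Let $m$ be the smallest index of a proper $A$-submodule of $X$. Then the subgroups $X$ and $Y$ are $\frac{1}{\sqrt m}$-orthogonal.
   Context: $G$ (with the chosen subgroups $X,Y$) has the structure of an $A$-group if $X$ is a right $A$-module and $Y$ is a left $A$-module (module structures whose underlying abelian groups are the groups $X$ and $Y$), and $[xr,y]=[x,ry]$ for all $r\in A$, $x\in X$, $y\in Y$. It is a Noetherian $A$-group if both $X$ and $Y$ are Noetherian $A$-modules. If there is no proper submodule of finite index, $m=\infty$ and $\frac1{\sqrt m}=0$. Two subgroups $X,Y$ with $G=\langle X,Y\rangle$ are $\varepsilon$-orthogonal if for every unitary representation $V$ of $G$ on a complex Hilbert space without nonzero $G$-invariant vectors one has $|\langle u,w\rangle|\le\varepsilon\|u\|\|w\|$ for all $u\in V^X$, $w\in V^Y$, where $V^H$ denotes the space of $H$-invariant vectors. $G$ is regarded as a discrete group. *)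

theory Defs
  imports
    "HOL-Analysis.Inner_Product"
    "HOL-Algebra.Generated_Groups"
    "HOL-Algebra.Ring"
    "HOL-Library.Extended_Nat"
begin

section \<open>Complex Hilbert spaces\<close>

text \<open>
  A complex inner product space is built on top of the library class of real inner product
  spaces: the real inner product is the real part of the complex one, so that the norm is
  \<open>norm x = sqrt (Re (cinner x x))\<close>, and the metric and topology are the library's. The form
  \<open>cinner\<close> is linear in its first argument.
\<close>

class complex_inner = real_inner +
  fixes scaleC :: "complex \<Rightarrow> 'a \<Rightarrow> 'a"  (infixr \<open>*\<^sub>C\<close> 75)
    and cinner :: "'a \<Rightarrow> 'a \<Rightarrow> complex"
  assumes scaleC_add_right: "a *\<^sub>C (x + y) = a *\<^sub>C x + a *\<^sub>C y"
    and scaleC_add_left: "(a + b) *\<^sub>C x = a *\<^sub>C x + b *\<^sub>C x"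
    and scaleC_scaleC: "a *\<^sub>C b *\<^sub>C x = (a * b) *\<^sub>C x"
    and scaleC_of_real: "complex_of_real r *\<^sub>C x = r *\<^sub>R x"
    and cinner_commute: "cinner x y = cnj (cinner y x)"
    and cinner_add_left: "cinner (x + y) z = cinner x z + cinner y z"
    and cinner_scaleC_left: "cinner (a *\<^sub>C x) y = a * cinner x y"
    and inner_eq_Re_cinner: "inner x y = Re (cinner x y)"

class chilbert_space = complex_inner + complete_space

lemma vector_space_scaleC: "vector_space (scaleC :: complex \<Rightarrow> 'a::complex_inner \<Rightarrow> 'a)"
  by (rule vector_space.intro)
    (simp_all add: scaleC_add_right scaleC_add_left scaleC_scaleC scaleC_of_real[of 1, simplified])

lemma cinner_self: "cinner x x = complex_of_real ((norm x)\<^sup>2)" for x :: "'a::complex_inner"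
  using cinner_commute[of x x]
  by (simp add: complex_eq_iff power2_norm_eq_inner inner_eq_Re_cinner)

instantiation complex :: chilbert_space
begin

definition scaleC_complex :: "complex \<Rightarrow> complex \<Rightarrow> complex"
  where "scaleC_complex a x = a * x"

definition cinner_complex :: "complex \<Rightarrow> complex \<Rightarrow> complex"
  where "cinner_complex x y = x * cnj y"

instance
  by standard
    (simp_all add: scaleC_complex_def cinner_complex_def algebra_simps scaleR_conv_of_real
      inner_complex_def)

end

section \<open>Unitary representations of discrete groups\<close>

definition unitary_op :: "('v::complex_inner \<Rightarrow> 'v) \<Rightarrow> bool" where
  "unitary_op U \<longleftrightarrow> Vector_Spaces.linear scaleC scaleC U \<and> bij U \<and>
     (\<forall>v w. cinner (U v) (U w) = cinner v w)"

definition unitary_group :: "('v::complex_inner \<Rightarrow> 'v) monoid" where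
  "unitary_group = \<lparr>carrier = {U. unitary_op U}, monoid.mult = (\<circ>), one = id\<rparr>"

lemma group_unitary_group: "group (unitary_group :: ('v::complex_inner \<Rightarrow> 'v) monoid)"
proof -
  interpret V: vector_space "scaleC :: complex \<Rightarrow> 'v \<Rightarrow> 'v"
    by (rule vector_space_scaleC)
  have comp: "unitary_op (U \<circ> W)" if "unitary_op U" "unitary_op W" for U W :: "'v \<Rightarrow> 'v"
    using that unfolding unitary_op_def
    by (auto intro: bij_comp Vector_Spaces.linear_compose)
  have id: "unitary_op (id :: 'v \<Rightarrow> 'v)"
    by (simp add: unitary_op_def V.linear_id)
  have inv: "unitary_op (inv_into UNIV U)" if U: "unitary_op U" for U :: "'v \<Rightarrow> 'v"
  proof -
    have "bij U" and lin: "Vector_Spaces.linear scaleC scaleC U"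
      using U by (auto simp: unitary_op_def)
    note s = surj_f_inv_f[OF bij_is_surj[OF \<open>bij U\<close>]]
      and i = inv_f_eq[OF bij_is_inj[OF \<open>bij U\<close>]]
    have "Vector_Spaces.linear scaleC scaleC (inv_into UNIV U)"
      unfolding Vector_Spaces.linear_iff
      by (intro conjI allI V.vector_space_axioms i)
        (use lin in \<open>simp_all add: Vector_Spaces.linear_iff s\<close>)
    moreover have "cinner (inv_into UNIV U v) (inv_into UNIV U w) = cinner v w" for v w
      using U s unfolding unitary_op_def by metis
    ultimately show ?thesis
      using \<open>bij U\<close> by (simp add: unitary_op_def bij_imp_bij_inv)
  qed
  show ?thesis
  proof (rule groupI)
    fix U :: "'v \<Rightarrow> 'v" assume U: "U \<in> carrier unitary_group"
    then have "inv_into UNIV U \<in> carrier unitary_group" "inv_into UNIV U \<circ> U = id"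
      using inv by (auto simp: unitary_group_def unitary_op_def bij_is_inj)
    then show "\<exists>W\<in>carrier unitary_group. W \<otimes>\<^bsub>unitary_group\<^esub> U = \<one>\<^bsub>unitary_group\<^esub>"
      by (auto simp: unitary_group_def)
  qed (auto simp: unitary_group_def comp id o_assoc)
qed

text \<open>
  The group is discrete, so no continuity is required of a representation. Since
  \<open>unitary_group\<close> is a group, members of \<open>hom G unitary_group\<close> preserve the unit.
\<close>

definition unitary_rep :: "('g, 'b) monoid_scheme \<Rightarrow> ('g \<Rightarrow> 'v::chilbert_space \<Rightarrow> 'v) \<Rightarrow> bool"
  where "unitary_rep G \<rho> \<longleftrightarrow> \<rho> \<in> hom G unitary_group"

definition invariants :: "('g \<Rightarrow> 'v \<Rightarrow> 'v) \<Rightarrow> 'g set \<Rightarrow> 'v set"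
  where "invariants \<rho> H = {v. \<forall>h\<in>H. \<rho> h v = v}"

text \<open>
  A definition cannot quantify over types, so the type of the representation space is a
  parameter; leaving it a type variable in a theorem quantifies over all Hilbert spaces.
\<close>

definition eps_orthogonal ::
    "'v::chilbert_space itself \<Rightarrow> ('g, 'b) monoid_scheme \<Rightarrow> 'g set \<Rightarrow> 'g set \<Rightarrow> real \<Rightarrow> bool"
  where "eps_orthogonal TYPE('v) G X Y \<epsilon> \<longleftrightarrow>
    (\<forall>\<rho> :: 'g \<Rightarrow> 'v \<Rightarrow> 'v. unitary_rep G \<rho> \<and> invariants \<rho> (carrier G) = {0} \<longrightarrow>
      (\<forall>u\<in>invariants \<rho> X. \<forall>w\<in>invariants \<rho> Y. cmod (cinner u w) \<le> \<epsilon> * norm u * norm w))"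

section \<open>Nilpotency class\<close>

definition commutator :: "('g, 'b) monoid_scheme \<Rightarrow> 'g \<Rightarrow> 'g \<Rightarrow> 'g"
  where "commutator G x y = x \<otimes>\<^bsub>G\<^esub> y \<otimes>\<^bsub>G\<^esub> inv\<^bsub>G\<^esub> x \<otimes>\<^bsub>G\<^esub> inv\<^bsub>G\<^esub> y"

text \<open>The series is indexed from 0, so \<open>lower_central G n\<close> is usually written $\gamma_{n+1}(G)$.\<close>

primrec lower_central :: "('g, 'b) monoid_scheme \<Rightarrow> nat \<Rightarrow> 'g set" where
  "lower_central G 0 = carrier G"
| "lower_central G (Suc n) =
     generate G {commutator G x y | x y. x \<in> lower_central G n \<and> y \<in> carrier G}"

definition has_nilpotency_class :: "('g, 'b) monoid_scheme \<Rightarrow> nat \<Rightarrow> bool" where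
  "has_nilpotency_class G c \<longleftrightarrow>
     lower_central G c = {\<one>\<^bsub>G\<^esub>} \<and> (\<forall>i<c. lower_central G i \<noteq> {\<one>\<^bsub>G\<^esub>})"

section \<open>Modules over a not necessarily commutative ring\<close>

text \<open>
  The library's modules are left modules over commutative rings. Here the underlying abelian
  group \<open>M\<close> is written multiplicatively, because it will be a subgroup of a
  multiplicative group.
\<close>

locale right_module = A?: ring A + M?: comm_group M
  for A :: "('r, 'c) ring_scheme" (structure) and M :: "('m, 'd) monoid_scheme" (structure) +
  fixes act :: "'m \<Rightarrow> 'r \<Rightarrow> 'm"
  assumes act_closed: "\<lbrakk>x \<in> carrier M; r \<in> carrier A\<rbrakk> \<Longrightarrow> act x r \<in> carrier M"
    and act_mult_left: "\<lbrakk>x \<in> carrier M; y \<in> carrier M; r \<in> carrier A\<rbrakk> \<Longrightarrow>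
      act (x \<otimes>\<^bsub>M\<^esub> y) r = act x r \<otimes>\<^bsub>M\<^esub> act y r"
    and act_add_right: "\<lbrakk>x \<in> carrier M; r \<in> carrier A; s \<in> carrier A\<rbrakk> \<Longrightarrow>
      act x (r \<oplus>\<^bsub>A\<^esub> s) = act x r \<otimes>\<^bsub>M\<^esub> act x s"
    and act_assoc: "\<lbrakk>x \<in> carrier M; r \<in> carrier A; s \<in> carrier A\<rbrakk> \<Longrightarrow>
      act x (r \<otimes>\<^bsub>A\<^esub> s) = act (act x r) s"
    and act_one: "x \<in> carrier M \<Longrightarrow> act x \<one>\<^bsub>A\<^esub> = x"

locale left_module = A?: ring A + M?: comm_group M
  for A :: "('r, 'c) ring_scheme" (structure) and M :: "('m, 'd) monoid_scheme" (structure) +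
  fixes act :: "'r \<Rightarrow> 'm \<Rightarrow> 'm"
  assumes act_closed: "\<lbrakk>r \<in> carrier A; x \<in> carrier M\<rbrakk> \<Longrightarrow> act r x \<in> carrier M"
    and act_mult_right: "\<lbrakk>r \<in> carrier A; x \<in> carrier M; y \<in> carrier M\<rbrakk> \<Longrightarrow>
      act r (x \<otimes>\<^bsub>M\<^esub> y) = act r x \<otimes>\<^bsub>M\<^esub> act r y"
    and act_add_left: "\<lbrakk>r \<in> carrier A; s \<in> carrier A; x \<in> carrier M\<rbrakk> \<Longrightarrow>
      act (r \<oplus>\<^bsub>A\<^esub> s) x = act r x \<otimes>\<^bsub>M\<^esub> act s x"
    and act_assoc: "\<lbrakk>r \<in> carrier A; s \<in> carrier A; x \<in> carrier M\<rbrakk> \<Longrightarrow>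
      act (r \<otimes>\<^bsub>A\<^esub> s) x = act r (act s x)"
    and act_one: "x \<in> carrier M \<Longrightarrow> act \<one>\<^bsub>A\<^esub> x = x"

definition right_submodule ::
    "('r, 'c) ring_scheme \<Rightarrow> ('m, 'd) monoid_scheme \<Rightarrow> ('m \<Rightarrow> 'r \<Rightarrow> 'm) \<Rightarrow> 'm set \<Rightarrow> bool"
  where "right_submodule A M act N \<longleftrightarrow>
    subgroup N M \<and> (\<forall>x\<in>N. \<forall>r\<in>carrier A. act x r \<in> N)"

definition left_submodule ::
    "('r, 'c) ring_scheme \<Rightarrow> ('m, 'd) monoid_scheme \<Rightarrow> ('r \<Rightarrow> 'm \<Rightarrow> 'm) \<Rightarrow> 'm set \<Rightarrow> bool"
  where "left_submodule A M act N \<longleftrightarrow>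
    subgroup N M \<and> (\<forall>r\<in>carrier A. \<forall>x\<in>N. act r x \<in> N)"

definition ascending_chain_condition :: "('m set \<Rightarrow> bool) \<Rightarrow> bool"
  where "ascending_chain_condition P \<longleftrightarrow>
    (\<forall>N :: nat \<Rightarrow> 'm set. (\<forall>i. P (N i) \<and> N i \<subseteq> N (Suc i)) \<longrightarrow> (\<exists>k. \<forall>i\<ge>k. N i = N k))"

section \<open>Groups with an A-group structure\<close>

definition A_group ::
    "('r, 'c) ring_scheme \<Rightarrow> ('g, 'b) monoid_scheme \<Rightarrow> 'g set \<Rightarrow> 'g set \<Rightarrow>
      ('g \<Rightarrow> 'r \<Rightarrow> 'g) \<Rightarrow> ('r \<Rightarrow> 'g \<Rightarrow> 'g) \<Rightarrow> bool"
  where "A_group A G X Y ract lact \<longleftrightarrow>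
    right_module A (G\<lparr>carrier := X\<rparr>) ract \<and>
    left_module A (G\<lparr>carrier := Y\<rparr>) lact \<and>
    (\<forall>r\<in>carrier A. \<forall>x\<in>X. \<forall>y\<in>Y. commutator G (ract x r) y = commutator G x (lact r y))"

definition noetherian_A_group ::
    "('r, 'c) ring_scheme \<Rightarrow> ('g, 'b) monoid_scheme \<Rightarrow> 'g set \<Rightarrow> 'g set \<Rightarrow>
      ('g \<Rightarrow> 'r \<Rightarrow> 'g) \<Rightarrow> ('r \<Rightarrow> 'g \<Rightarrow> 'g) \<Rightarrow> bool"
  where "noetherian_A_group A G X Y ract lact \<longleftrightarrow>
    A_group A G X Y ract lact \<and>
    ascending_chain_condition (right_submodule A (G\<lparr>carrier := X\<rparr>) ract) \<and>
    ascending_chain_condition (left_submodule A (G\<lparr>carrier := Y\<rparr>) lact)"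

section \<open>The smallest index of a proper submodule\<close>

definition subgroup_index :: "('m, 'd) monoid_scheme \<Rightarrow> 'm set \<Rightarrow> enat"
  where "subgroup_index M N =
    (if finite (rcosets\<^bsub>M\<^esub> N) then enat (card (rcosets\<^bsub>M\<^esub> N)) else \<infinity>)"

text \<open>This is \<open>\<infinity>\<close> if no proper submodule has finite index; in particular, \<open>Inf {} = \<infinity>\<close>.\<close>

definition min_right_submodule_index ::
    "('r, 'c) ring_scheme \<Rightarrow> ('m, 'd) monoid_scheme \<Rightarrow> ('m \<Rightarrow> 'r \<Rightarrow> 'm) \<Rightarrow> enat"
  where "min_right_submodule_index A M act =
    Inf (subgroup_index M ` {N. right_submodule A M act N \<and> N \<noteq> carrier M})"

definition inverse_sqrt :: "enat \<Rightarrow> real"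
  where "inverse_sqrt m = (case m of enat k \<Rightarrow> 1 / sqrt (real k) | \<infinity> \<Rightarrow> 0)"

end

theory Submission
  imports Defs "HOL-Analysis.Starlike"
begin

text \<open>
  Commutators \<open>[x, y]\<close> are central in a group of class two, so \<open>(x, y) \<mapsto> [x, y]\<close> is
  biadditive on \<open>X \<times> Y\<close>. To a vector \<open>v\<close> of a representation attach the left radical
  \<open>N(v) = {x \<in> X. [x, y] fixes v for all y \<in> Y}\<close> of this pairing as \<open>v\<close> sees it. The
  identity \<open>[xr, y] = [x, ry]\<close> makes \<open>N(v)\<close> an \<open>A\<close>-submodule of \<open>X\<close>
  (\<open>radical_right_submodule\<close>). Call an invariant subspace isotypic if all its nonzero vectors have
  the same radical \<open>N\<close>; it plays the part that an irreducible representation, where the commutators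
  act by scalars, would play.

  Let \<open>u\<close> be fixed by \<open>X\<close> and \<open>w\<close> by \<open>Y\<close>, both in an isotypic subspace.
  If \<open>N \<noteq> X\<close>, the translates \<open>xw\<close> for \<open>x\<close> in different cosets of
  \<open>N\<close> are pairwise orthogonal (\<open>isotypic_translate_orthogonal\<close>): if the commutators acted by
  scalars, these would be eigenvectors of \<open>Y\<close> for the different characters
  \<open>y \<mapsto> [y, x]\<close>. On the other hand, \<open>u\<close> has the same inner product with all of them, so Bessel's inequality for
  \<open>n\<close> translates gives \<open>sqrt n * \<bar>\<langle>u, w\<rangle>\<bar> \<le> norm u * norm w\<close> for all
  \<open>n \<le> |X : N|\<close>, in particular for all \<open>n \<le> m\<close> (\<open>isotypic_cosine_bound\<close>). If
  \<open>N = X\<close>, the actions of \<open>X\<close> and \<open>Y\<close> commute, so the projection of \<open>u\<close> to the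
  \<open>Y\<close>-fixed vectors is fixed by \<open>X\<close> and \<open>Y\<close>, hence zero
  (\<open>isotypic_trivial_orthogonal\<close>).

  It remains to pass from isotypic subspaces to the whole space. In every nonzero closed invariant
  subspace, the ascending chain condition yields a vector with maximal radical \<open>N\<close>, and the vectors
  whose radical contains \<open>N\<close> form a nonzero isotypic subspace (\<open>isotypic_exists\<close>). By Zorn's
  lemma there is a maximal closed invariant subspace with the required bound. The bound passes to orthogonal
  sums by the Cauchy-Schwarz inequality in the plane, so the complement of this subspace, which would otherwise
  contain a nonzero isotypic subspace, is zero (\<open>cosine_bound_exhaustion\<close>).

  Multiplying \<open>u\<close> by a complex number of modulus one makes \<open>\<langle>u, w\<rangle>\<close> real and
  nonnegative, so all this can be done with real orthogonal representations.
\<close>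

section \<open>Projections in Hilbert spaces\<close>

text \<open>
  The point \<open>p\<close> is the nearest point of \<open>S\<close> to \<open>v\<close>. By the parallelogram
  identity a sequence in \<open>S\<close> whose distances to \<open>v\<close> approach the infimum is Cauchy, and
  completeness provides its limit.
\<close>

lemma orthogonal_decomposition_exists:
  fixes v :: "'v::{real_inner,complete_space}"
  assumes S: "subspace S" "closed S"
  shows "\<exists>p\<in>S. v - p \<in> S\<^sup>\<bottom>"
proof -
  define D where "D = (\<lambda>s. (norm (v - s))\<^sup>2) ` S"
  define d where "d = Inf D"
  have "0 \<in> S" using S subspace_0 by blast
  then have ne: "D \<noteq> {}" by (auto simp: D_def)
  have bdd: "bdd_below D" by (intro bdd_belowI[of _ 0]) (auto simp: D_def)
  have lower: "d \<le> (norm (v - s))\<^sup>2" if "s \<in> S" for s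
    unfolding d_def using that bdd by (intro cInf_lower) (auto simp: D_def)
  have "\<exists>s\<in>S. (norm (v - s))\<^sup>2 < d + 1 / real (Suc n)" for n
  proof -
    have "Inf D < d + 1 / real (Suc n)" by (simp add: d_def)
    then show ?thesis using cInf_lessD[OF ne] by (auto simp: D_def)
  qed
  then obtain s where s: "\<And>n. s n \<in> S" "\<And>n. (norm (v - s n))\<^sup>2 < d + 1 / real (Suc n)"
    by metis
  \<comment> \<open>The midpoint of two points of \<open>S\<close> is no closer to \<open>v\<close> than the infimum.\<close>
  have parallelogram: "(norm (s m - s n))\<^sup>2 \<le> 2 / real (Suc m) + 2 / real (Suc n)" for m n
  proof -
    have "(1/2) *\<^sub>R (s m + s n) \<in> S"
      using s(1) S(1) by (simp add: subspace_add subspace_scale)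
    then have "d \<le> (norm (v - (1/2) *\<^sub>R (s m + s n)))\<^sup>2" by (rule lower)
    moreover have "(norm (s m - s n))\<^sup>2 = 2 * (norm (v - s m))\<^sup>2 + 2 * (norm (v - s n))\<^sup>2
        - 4 * (norm (v - (1/2) *\<^sub>R (s m + s n)))\<^sup>2"
      by (simp add: power2_norm_eq_inner inner_diff_left inner_diff_right inner_add_left
          inner_add_right inner_commute algebra_simps)
    ultimately show ?thesis using s(2)[of m] s(2)[of n] by simp
  qed
  have "Cauchy s"
  proof (rule metric_CauchyI)
    fix e :: real assume "e > 0"
    then obtain N where N: "4 / e\<^sup>2 < real N" using reals_Archimedean2 by blast
    have "N > 0" using N \<open>e > 0\<close> by (metis gr0I not_less_iff_gr_or_eq of_nat_0 zero_less_divide_iff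
          zero_less_numeral zero_less_power)
    have "dist (s m) (s n) < e" if "m \<ge> N" "n \<ge> N" for m n
    proof -
      have "2 / real (Suc k) \<le> 2 / real N" if "k \<ge> N" for k
        using that \<open>N > 0\<close> by (intro divide_left_mono) auto
      then have "(norm (s m - s n))\<^sup>2 \<le> 4 / real N"
        using parallelogram[of m n] \<open>m \<ge> N\<close> \<open>n \<ge> N\<close> by (smt (verit) add_divide_distrib)
      also have "\<dots> < e\<^sup>2"
        using N \<open>e > 0\<close> \<open>N > 0\<close> by (simp add: field_simps)
      finally show ?thesis
        using \<open>e > 0\<close> by (simp add: dist_norm power_less_imp_less_base)
    qed
    then show "\<exists>M. \<forall>m\<ge>M. \<forall>n\<ge>M. dist (s m) (s n) < e" by blast
  qed
  then obtain p where p: "s \<longlonglongrightarrow> p" using Cauchy_convergent convergent_def by blast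
  have "p \<in> S" using closed_sequentially[OF S(2)] s(1) p by blast
  have "(\<lambda>n. (norm (v - s n))\<^sup>2) \<longlonglongrightarrow> (norm (v - p))\<^sup>2"
    by (intro tendsto_intros p)
  moreover have "(\<lambda>n. d + 1 / real (Suc n)) \<longlonglongrightarrow> d + 0"
    by (intro tendsto_intros LIMSEQ_inverse_real_of_nat[unfolded inverse_eq_divide])
  moreover have "\<exists>N. \<forall>n\<ge>N. (norm (v - s n))\<^sup>2 \<le> d + 1 / real (Suc n)"
    using s(2) less_imp_le by blast
  ultimately have "(norm (v - p))\<^sup>2 \<le> d + 0" by (rule LIMSEQ_le)
  then have pd: "(norm (v - p))\<^sup>2 \<le> d" by simp
  have "inner t (v - p) = 0" if t: "t \<in> S" for t
  proof (cases "t = 0")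
    case False
    define c where "c = inner t (v - p) / inner t t"
    have tt: "inner t t > 0" using False by simp
    \<comment> \<open>Moving from \<open>p\<close> by the component of \<open>v - p\<close> along \<open>t\<close> cannot decrease the distance.\<close>
    have "p + c *\<^sub>R t \<in> S" using \<open>p \<in> S\<close> t S(1) by (simp add: subspace_add subspace_scale)
    then have "(norm (v - p))\<^sup>2 \<le> (norm (v - (p + c *\<^sub>R t)))\<^sup>2"
      using lower pd order_trans by blast
    also have "\<dots> = (norm (v - p))\<^sup>2 - 2 * c * inner t (v - p) + c * c * inner t t"
      by (simp add: power2_norm_eq_inner inner_diff_left inner_diff_right inner_add_left
          inner_add_right inner_commute algebra_simps)
    also have "\<dots> = (norm (v - p))\<^sup>2 - (inner t (v - p))\<^sup>2 / inner t t"
      using tt by (simp add: c_def power2_eq_square field_simps)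
    finally have "(inner t (v - p))\<^sup>2 / inner t t \<le> 0" by simp
    then show ?thesis using tt by (simp add: divide_le_0_iff)
  qed simp
  then show ?thesis using \<open>p \<in> S\<close> by (auto simp: orthogonal_comp_def orthogonal_def)
qed

lemma orthogonal_decomposition_unique:
  fixes p p' :: "'v::real_inner"
  assumes "subspace S" "p \<in> S" "v - p \<in> S\<^sup>\<bottom>" "p' \<in> S" "v - p' \<in> S\<^sup>\<bottom>"
  shows "p = p'"
proof -
  have "p - p' \<in> S" using assms by (simp add: subspace_diff)
  then have "inner (p - p') (v - p) = 0" "inner (p - p') (v - p') = 0"
    using assms by (auto simp: orthogonal_comp_def orthogonal_def)
  then have "inner (p - p') (p - p') = 0" by (simp add: inner_diff_right)
  then show ?thesis by simp
qed

definition proj :: "'v::real_inner set \<Rightarrow> 'v \<Rightarrow> 'v"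
  where "proj S v = (THE p. p \<in> S \<and> v - p \<in> S\<^sup>\<bottom>)"

lemma proj_eqI:
  assumes "subspace S" "p \<in> S" "v - p \<in> S\<^sup>\<bottom>"
  shows "proj S v = p"
  unfolding proj_def using assms orthogonal_decomposition_unique[of S] by blast

context
  fixes S :: "'v::{real_inner,complete_space} set"
  assumes S: "subspace S" "closed S"
begin

lemma proj_mem: "proj S v \<in> S" and proj_residual: "v - proj S v \<in> S\<^sup>\<bottom>"
  using orthogonal_decomposition_exists[OF S, of v] proj_eqI[OF S(1)] by metis+

lemma inner_residual: "s \<in> S \<Longrightarrow> inner s (v - proj S v) = 0"
  using proj_residual by (auto simp: orthogonal_comp_def orthogonal_def)

lemma inner_proj: "s \<in> S \<Longrightarrow> inner s (proj S v) = inner s v"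
  using inner_residual[of s v] by (simp add: inner_diff_right)

lemma norm_proj_squared: "(norm v)\<^sup>2 = (norm (proj S v))\<^sup>2 + (norm (v - proj S v))\<^sup>2"
  using inner_residual[OF proj_mem, of v v]
  by (simp add: power2_norm_eq_inner inner_diff_left inner_diff_right inner_commute)

lemma norm_proj_le: "norm (proj S v) \<le> norm v"
  using norm_proj_squared[of v] by (simp add: power2_le_imp_le)

lemma norm_residual_le: "s \<in> S \<Longrightarrow> norm (v - proj S v) \<le> norm (v - s)"
proof -
  assume s: "s \<in> S"
  then have "inner (proj S v - s) (v - proj S v) = 0"
    by (intro inner_residual) (simp add: S proj_mem subspace_diff)
  then have "(norm (v - s))\<^sup>2 = (norm (v - proj S v))\<^sup>2 + (norm (proj S v - s))\<^sup>2"
    by (simp add: power2_norm_eq_inner inner_diff_left inner_diff_right inner_commute)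
  then show ?thesis by (simp add: power2_le_imp_le)
qed

lemma inner_split_proj:
  "inner u w = inner (proj S u) (proj S w) + inner (u - proj S u) (w - proj S w)"
  using inner_residual[OF proj_mem, of u w] inner_residual[OF proj_mem, of w u]
  by (simp add: inner_diff_left inner_diff_right inner_commute)

end

lemma closed_orthogonal_comp: "closed (S\<^sup>\<bottom>)" for S :: "'v::real_inner set"
proof -
  have "S\<^sup>\<bottom> = (\<Inter>s\<in>S. {v. inner s v = 0})"
    by (auto simp: orthogonal_comp_def orthogonal_def)
  then show ?thesis by (auto intro!: closed_INT closed_Collect_eq continuous_intros)
qed

lemma subspace_closure: "subspace S \<Longrightarrow> subspace (closure S)" for S :: "'v::real_normed_vector set"
proof -
  assume S: "subspace S"
  show ?thesis
  proof (rule subspaceI)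
    show "0 \<in> closure S" using S subspace_0 closure_subset by blast
    show "x + y \<in> closure S" if xy: "x \<in> closure S" "y \<in> closure S" for x y
    proof -
      obtain f g where f: "\<And>n. f n \<in> S" "f \<longlonglongrightarrow> x" and g: "\<And>n. g n \<in> S" "g \<longlonglongrightarrow> y"
        using xy by (auto simp: closure_sequential)
      have "(\<lambda>n. f n + g n) \<longlonglongrightarrow> x + y" using f g by (intro tendsto_intros)
      moreover have "\<forall>n. f n + g n \<in> S" using f g S by (simp add: subspace_add)
      ultimately show ?thesis
        unfolding closure_sequential by (intro exI[of _ "\<lambda>n. f n + g n"]) simp
    qed
    show "c *\<^sub>R x \<in> closure S" if x: "x \<in> closure S" for c x
    proof -
      obtain f where f: "\<And>n. f n \<in> S" "f \<longlonglongrightarrow> x"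
        using x by (auto simp: closure_sequential)
      have "(\<lambda>n. c *\<^sub>R f n) \<longlonglongrightarrow> c *\<^sub>R x" using f by (intro tendsto_intros)
      moreover have "\<forall>n. c *\<^sub>R f n \<in> S" using f S by (simp add: subspace_scale)
      ultimately show ?thesis
        unfolding closure_sequential by (intro exI[of _ "\<lambda>n. c *\<^sub>R f n"]) simp
    qed
  qed
qed

lemma subspace_Union_chain:
  fixes C :: "'v::real_vector set set"
  assumes "C \<noteq> {}" "\<And>S. S \<in> C \<Longrightarrow> subspace S"
    and total: "\<And>S T. S \<in> C \<Longrightarrow> T \<in> C \<Longrightarrow> S \<subseteq> T \<or> T \<subseteq> S"
  shows "subspace (\<Union>C)"
proof (rule subspaceI)
  show "0 \<in> \<Union>C" using assms subspace_0 by blast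
  show "x + y \<in> \<Union>C" if xy: "x \<in> \<Union>C" "y \<in> \<Union>C" for x y
  proof -
    obtain S T where ST: "S \<in> C" "x \<in> S" "T \<in> C" "y \<in> T" using xy by blast
    then obtain U where U: "U \<in> C" "x \<in> U" "y \<in> U" using total[OF ST(1,3)] by auto
    then have "x + y \<in> U" using assms(2) by (simp add: subspace_add)
    then show ?thesis using U by auto
  qed
  show "c *\<^sub>R x \<in> \<Union>C" if "x \<in> \<Union>C" for c x
    using that assms(2) by (auto intro: subspace_scale)
qed

section \<open>Orthogonal representations and exhaustion\<close>

locale orthogonal_rep = group G for G :: "('g, 'b) monoid_scheme" (structure) +
  fixes \<rho> :: "'g \<Rightarrow> 'v::{real_inner,complete_space} \<Rightarrow> 'v"
  assumes rho_linear: "g \<in> carrier G \<Longrightarrow> linear (\<rho> g)"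
    and rho_mult: "\<lbrakk>g \<in> carrier G; h \<in> carrier G\<rbrakk> \<Longrightarrow> \<rho> (g \<otimes> h) v = \<rho> g (\<rho> h v)"
    and rho_one: "\<rho> \<one> v = v"
    and inner_rho: "g \<in> carrier G \<Longrightarrow> inner (\<rho> g v) (\<rho> g w) = inner v w"
begin

lemma rho_inv [simp]: "g \<in> carrier G \<Longrightarrow> \<rho> (inv g) (\<rho> g v) = v"
  "g \<in> carrier G \<Longrightarrow> \<rho> g (\<rho> (inv g) v) = v"
  by (simp_all flip: rho_mult add: rho_one)

lemma norm_rho: "g \<in> carrier G \<Longrightarrow> norm (\<rho> g v) = norm v"
  by (simp add: norm_eq_sqrt_inner inner_rho)

lemma inner_rho_adjoint: "g \<in> carrier G \<Longrightarrow> inner v (\<rho> g w) = inner (\<rho> (inv g) v) w"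
  using inner_rho[of g "\<rho> (inv g) v" w] by simp

lemma rho_diff: "g \<in> carrier G \<Longrightarrow> \<rho> g (v - w) = \<rho> g v - \<rho> g w"
  using rho_linear linear_diff by blast

lemma continuous_rho: "g \<in> carrier G \<Longrightarrow> continuous_on A (\<rho> g)"
  unfolding continuous_on_iff dist_norm by (metis norm_rho rho_diff)

lemma subspace_fixed: "g \<in> carrier G \<Longrightarrow> subspace {v. \<rho> g v = v}"
  using rho_linear[of g] by (auto simp: subspace_def linear_add linear_scale linear_0)

lemma closed_fixed: "g \<in> carrier G \<Longrightarrow> closed {v. \<rho> g v = v}"
  by (intro closed_Collect_eq continuous_rho continuous_intros)

lemma invariants_eq_Inter: "invariants \<rho> H = (\<Inter>h\<in>H. {v. \<rho> h v = v})"
  by (auto simp: invariants_def)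

lemma subspace_invariants: "H \<subseteq> carrier G \<Longrightarrow> subspace (invariants \<rho> H)"
  unfolding invariants_eq_Inter by (rule subspace_Inter) (auto simp: subspace_fixed)

lemma closed_invariants: "H \<subseteq> carrier G \<Longrightarrow> closed (invariants \<rho> H)"
  unfolding invariants_eq_Inter by (auto intro!: closed_INT closed_fixed)

lemma rho_orthogonal_comp:
  assumes g: "g \<in> carrier G" and S: "\<rho> (inv g) ` S \<subseteq> S" and v: "v \<in> S\<^sup>\<bottom>"
  shows "\<rho> g v \<in> S\<^sup>\<bottom>"
  using assms by (auto simp: orthogonal_comp_def orthogonal_def inner_rho_adjoint image_subset_iff)

text \<open>
  An orthogonal operator that maps \<open>S\<close> onto itself also preserves its complement, so it carries the
  decomposition of \<open>v\<close> to that of the image of \<open>v\<close>.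
\<close>

lemma proj_rho:
  assumes S: "subspace S" "closed S" and g: "g \<in> carrier G"
    and stable: "\<rho> g ` S \<subseteq> S" "\<rho> (inv g) ` S \<subseteq> S"
  shows "proj S (\<rho> g v) = \<rho> g (proj S v)"
proof (rule proj_eqI[OF S(1)])
  show "\<rho> g (proj S v) \<in> S" using stable proj_mem[OF S] by blast
  show "\<rho> g v - \<rho> g (proj S v) \<in> S\<^sup>\<bottom>"
    using rho_orthogonal_comp[OF g stable(2) proj_residual[OF S]] g by (simp add: rho_diff)
qed

definition closed_subrep :: "'v set \<Rightarrow> bool" where
  "closed_subrep S \<longleftrightarrow> subspace S \<and> closed S \<and> (\<forall>g\<in>carrier G. \<rho> g ` S \<subseteq> S)"

lemma closed_subrep_orthogonal_comp:
  assumes "closed_subrep S" shows "closed_subrep (S\<^sup>\<bottom>)"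
proof -
  have "\<rho> g ` (S\<^sup>\<bottom>) \<subseteq> S\<^sup>\<bottom>" if "g \<in> carrier G" for g
    using assms that rho_orthogonal_comp[of g S] by (auto simp: closed_subrep_def)
  then show ?thesis
    by (simp add: closed_subrep_def subspace_orthogonal_comp closed_orthogonal_comp)
qed

lemma closed_subrep_Int: "closed_subrep S \<Longrightarrow> closed_subrep T \<Longrightarrow> closed_subrep (S \<inter> T)"
  by (simp add: closed_subrep_def subspace_inter closed_Int image_subset_iff)

lemma proj_invariants:
  assumes S: "closed_subrep S" and H: "H \<subseteq> carrier G" and v: "v \<in> invariants \<rho> H"
  shows "proj S v \<in> invariants \<rho> H"
proof -
  have "\<rho> h (proj S v) = proj S v" if "h \<in> H" for h
    using S H v that proj_rho[of S h v] by (auto simp: closed_subrep_def invariants_def)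
  then show ?thesis by (simp add: invariants_def)
qed

lemma closed_subrep_closure_Union_chain:
  assumes "C \<noteq> {}" "\<And>S. S \<in> C \<Longrightarrow> closed_subrep S"
    and total: "\<And>S T. S \<in> C \<Longrightarrow> T \<in> C \<Longrightarrow> S \<subseteq> T \<or> T \<subseteq> S"
  shows "closed_subrep (closure (\<Union>C))"
proof -
  have "subspace S" if "S \<in> C" for S using assms(2)[OF that] by (simp add: closed_subrep_def)
  then have "subspace (closure (\<Union>C))"
    by (rule subspace_closure[OF subspace_Union_chain[OF assms(1) _ total]])
  moreover have "\<rho> g ` closure (\<Union>C) \<subseteq> closure (\<Union>C)" if g: "g \<in> carrier G" for g
  proof -
    have "\<rho> g ` S \<subseteq> S" if "S \<in> C" for S
      using assms(2)[OF that] g by (simp add: closed_subrep_def)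
    then have "\<rho> g ` \<Union>C \<subseteq> closure (\<Union>C)" using closure_subset[of "\<Union>C"] by fast
    then show ?thesis by (rule image_closure_subset[OF continuous_rho[OF g] closed_closure])
  qed
  ultimately show ?thesis by (simp add: closed_subrep_def)
qed

text \<open>
  Geometrically, \<open>\<epsilon>\<close> bounds the cosine of the angle between the \<open>H\<close>-fixed and the
  \<open>K\<close>-fixed vectors of \<open>S\<close>.
\<close>

definition cosine_bound :: "'g set \<Rightarrow> 'g set \<Rightarrow> real \<Rightarrow> 'v set \<Rightarrow> bool" where
  "cosine_bound H K \<epsilon> S \<longleftrightarrow> (\<forall>u\<in>invariants \<rho> H \<inter> S. \<forall>w\<in>invariants \<rho> K \<inter> S.
     \<bar>inner u w\<bar> \<le> \<epsilon> * norm u * norm w)"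

text \<open>
  A pair of vectors in the closure lies close to a single member \<open>S\<close> of the chain. Its projections to
  \<open>S\<close> are still fixed by \<open>H\<close> and \<open>K\<close>, and are no longer than the vectors themselves.
\<close>

lemma cosine_bound_closure_Union_chain:
  assumes H: "H \<subseteq> carrier G" and K: "K \<subseteq> carrier G" and "0 \<le> \<epsilon>"
    and C: "\<And>S. S \<in> C \<Longrightarrow> closed_subrep S" "\<And>S. S \<in> C \<Longrightarrow> cosine_bound H K \<epsilon> S"
    and total: "\<And>S T. S \<in> C \<Longrightarrow> T \<in> C \<Longrightarrow> S \<subseteq> T \<or> T \<subseteq> S"
  shows "cosine_bound H K \<epsilon> (closure (\<Union>C))"
  unfolding cosine_bound_def
proof (intro ballI)
  fix u w
  assume u: "u \<in> invariants \<rho> H \<inter> closure (\<Union>C)" and w: "w \<in> invariants \<rho> K \<inter> closure (\<Union>C)"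
  show "\<bar>inner u w\<bar> \<le> \<epsilon> * norm u * norm w"
  proof (rule field_le_epsilon)
    fix e :: real assume "e > 0"
    \<comment> \<open>The product of two residuals shorter than \<open>d\<close> is at most \<open>e\<close>.\<close>
    define d where "d = sqrt e"
    have d: "d > 0" "d * d = e" using \<open>e > 0\<close> by (auto simp: d_def)
    obtain a where a: "a \<in> \<Union>C" "dist a u < d"
      using IntD2[OF u, unfolded closure_approachable] d(1) by blast
    obtain b where b: "b \<in> \<Union>C" "dist b w < d"
      using IntD2[OF w, unfolded closure_approachable] d(1) by blast
    obtain A B where AB: "A \<in> C" "a \<in> A" "B \<in> C" "b \<in> B" using a b by blast
    then obtain S where S: "S \<in> C" "a \<in> S" "b \<in> S" using total[OF AB(1,3)] by auto
    have sub: "subspace S" "closed S" using C(1)[OF S(1)] by (auto simp: closed_subrep_def)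
    have "norm (u - proj S u) \<le> d" "norm (w - proj S w) \<le> d"
      using norm_residual_le[OF sub, of a u] norm_residual_le[OF sub, of b w] S a b
      by (auto simp: dist_norm norm_minus_commute)
    then have "norm (u - proj S u) * norm (w - proj S w) \<le> e"
      using d by (metis mult_mono norm_ge_zero less_imp_le)
    then have "\<bar>inner (u - proj S u) (w - proj S w)\<bar> \<le> e"
      using Cauchy_Schwarz_ineq2 order_trans by blast
    moreover have "proj S u \<in> invariants \<rho> H \<inter> S" "proj S w \<in> invariants \<rho> K \<inter> S"
      using proj_invariants[OF C(1)[OF S(1)]] H K u w proj_mem[OF sub] by auto
    then have "\<bar>inner (proj S u) (proj S w)\<bar> \<le> \<epsilon> * norm (proj S u) * norm (proj S w)"
      using C(2)[OF S(1)] unfolding cosine_bound_def by blast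
    moreover have "\<epsilon> * norm (proj S u) * norm (proj S w) \<le> \<epsilon> * norm u * norm w"
      using \<open>0 \<le> \<epsilon>\<close> norm_proj_le[OF sub] by (intro mult_mono mult_left_mono) auto
    ultimately show "\<bar>inner u w\<bar> \<le> \<epsilon> * norm u * norm w + e"
      using inner_split_proj[OF sub, of u w] by linarith
  qed
qed

text \<open>
  The space \<open>(S\<^sup>\<bottom> \<inter> T\<^sup>\<bottom>)\<^sup>\<bottom>\<close> is the orthogonal sum of \<open>S\<close> and
  \<open>T\<close>, written in a form that is visibly closed and invariant. Components in \<open>S\<close> and
  \<open>T\<close> contribute separately to the inner product, and their two bounds combine by the Cauchy-Schwarz
  inequality for pairs of real numbers.
\<close>

lemma cosine_bound_orthogonal_sum:
  assumes H: "H \<subseteq> carrier G" and K: "K \<subseteq> carrier G" and "0 \<le> \<epsilon>"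
    and S: "closed_subrep S" "cosine_bound H K \<epsilon> S"
    and T: "closed_subrep T" "cosine_bound H K \<epsilon> T"
    and orth: "T \<subseteq> S\<^sup>\<bottom>"
  shows "cosine_bound H K \<epsilon> ((S\<^sup>\<bottom> \<inter> T\<^sup>\<bottom>)\<^sup>\<bottom>)"
  unfolding cosine_bound_def
proof (intro ballI)
  have sS: "subspace S" "closed S" and sT: "subspace T" "closed T"
    using S T by (auto simp: closed_subrep_def)
  have split: "v - proj S v = proj T v" if v: "v \<in> (S\<^sup>\<bottom> \<inter> T\<^sup>\<bottom>)\<^sup>\<bottom>" for v
  proof -
    \<comment> \<open>The remainder \<open>?r\<close> is orthogonal to \<open>S\<close>, to \<open>T\<close> and to \<open>v\<close>, hence to itself.\<close>
    let ?r = "v - proj S v - proj T v"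
    have "proj T v \<in> S\<^sup>\<bottom>" using proj_mem[OF sT] orth by blast
    then have rS: "?r \<in> S\<^sup>\<bottom>"
      by (intro subspace_diff subspace_orthogonal_comp proj_residual[OF sS])
    have "proj S v \<in> T\<^sup>\<bottom>"
      using proj_mem[OF sS, of v] orth by (auto simp: orthogonal_comp_def orthogonal_commute)
    then have "v - proj T v - proj S v \<in> T\<^sup>\<bottom>"
      by (intro subspace_diff subspace_orthogonal_comp proj_residual[OF sT])
    then have rT: "?r \<in> T\<^sup>\<bottom>" by (simp add: algebra_simps)
    have "inner ?r v = 0" using v rS rT by (auto simp: orthogonal_comp_def orthogonal_def)
    moreover have "inner ?r (proj S v) = 0" "inner ?r (proj T v) = 0"
      using rS rT proj_mem[OF sS] proj_mem[OF sT]
      by (auto simp: orthogonal_comp_def orthogonal_def inner_commute)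
    ultimately have "inner ?r ?r = 0" by (simp add: inner_diff_right)
    then show ?thesis by simp
  qed
  fix u w
  assume u: "u \<in> invariants \<rho> H \<inter> (S\<^sup>\<bottom> \<inter> T\<^sup>\<bottom>)\<^sup>\<bottom>" and w: "w \<in> invariants \<rho> K \<inter> (S\<^sup>\<bottom> \<inter> T\<^sup>\<bottom>)\<^sup>\<bottom>"
  have norms: "(norm v)\<^sup>2 = (norm (proj S v))\<^sup>2 + (norm (proj T v))\<^sup>2"
    if "v \<in> (S\<^sup>\<bottom> \<inter> T\<^sup>\<bottom>)\<^sup>\<bottom>" for v
    using norm_proj_squared[OF sS, of v] split[OF that] by simp
  define a b c d where abcd: "a = norm (proj S u)" "b = norm (proj T u)"
    "c = norm (proj S w)" "d = norm (proj T w)"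
  have "inner u w = inner (proj S u) (proj S w) + inner (proj T u) (proj T w)"
    using inner_split_proj[OF sS, of u w] split u w by auto
  moreover have "proj S u \<in> invariants \<rho> H \<inter> S" "proj S w \<in> invariants \<rho> K \<inter> S"
      "proj T u \<in> invariants \<rho> H \<inter> T" "proj T w \<in> invariants \<rho> K \<inter> T"
    using proj_invariants[OF S(1)] proj_invariants[OF T(1)] H K u w proj_mem[OF sS] proj_mem[OF sT]
    by auto
  then have "\<bar>inner (proj S u) (proj S w)\<bar> \<le> \<epsilon> * a * c" "\<bar>inner (proj T u) (proj T w)\<bar> \<le> \<epsilon> * b * d"
    using S(2) T(2) unfolding cosine_bound_def abcd by blast+
  ultimately have 1: "\<bar>inner u w\<bar> \<le> \<epsilon> * (a * c + b * d)"
    by (simp add: algebra_simps)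
  \<comment> \<open>Lagrange's identity gives the Cauchy-Schwarz inequality for \<open>(a, b)\<close> and \<open>(c, d)\<close>.\<close>
  have "0 \<le> (a * d - b * c)\<^sup>2" by simp
  then have "(a * c + b * d)\<^sup>2 \<le> (a\<^sup>2 + b\<^sup>2) * (c\<^sup>2 + d\<^sup>2)"
    by (simp add: power2_eq_square algebra_simps)
  also have "\<dots> = (norm u * norm w)\<^sup>2"
    using norms[OF IntD2[OF u]] norms[OF IntD2[OF w]] by (simp add: abcd power_mult_distrib)
  finally have "a * c + b * d \<le> norm u * norm w"
    by (rule power2_le_imp_le) simp
  then have "\<epsilon> * (a * c + b * d) \<le> \<epsilon> * (norm u * norm w)"
    using \<open>0 \<le> \<epsilon>\<close> by (rule mult_left_mono)
  with 1 have "\<bar>inner u w\<bar> \<le> \<epsilon> * (norm u * norm w)" by (rule order_trans)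
  then show "\<bar>inner u w\<bar> \<le> \<epsilon> * norm u * norm w" by (simp only: mult.assoc)
qed

text \<open>
  This replaces the decomposition of the representation into a direct integral of simpler ones: it is enough
  to find one good piece in each nonzero closed invariant subspace. If a maximal subspace with the bound
  were not everything, a good piece of its complement could be added to it.
\<close>

lemma cosine_bound_exhaustion:
  assumes H: "H \<subseteq> carrier G" and K: "K \<subseteq> carrier G" and "0 \<le> \<epsilon>"
    and piece: "\<And>R. closed_subrep R \<Longrightarrow> R \<noteq> {0} \<Longrightarrow>
      \<exists>T\<subseteq>R. closed_subrep T \<and> T \<noteq> {0} \<and> cosine_bound H K \<epsilon> T"
  shows "cosine_bound H K \<epsilon> UNIV"
proof -
  define \<A> where "\<A> = {S. closed_subrep S \<and> cosine_bound H K \<epsilon> S}"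
  have "{0} \<in> \<A>"
    using rho_linear by (auto simp: \<A>_def closed_subrep_def cosine_bound_def linear_0)
  have "\<exists>M\<in>\<A>. \<forall>S\<in>\<A>. M \<subseteq> S \<longrightarrow> S = M"
  proof (rule subset_Zorn)
    fix C assume C: "subset.chain \<A> C"
    show "\<exists>U\<in>\<A>. \<forall>S\<in>C. S \<subseteq> U"
    proof (cases "C = {}")
      case False
      have mem: "closed_subrep S" "cosine_bound H K \<epsilon> S" if "S \<in> C" for S
        using C that by (auto simp: subset.chain_def \<A>_def)
      have total: "S \<subseteq> T \<or> T \<subseteq> S" if "S \<in> C" "T \<in> C" for S T
        using C that by (meson subset_chain_def)
      have "closed_subrep (closure (\<Union>C))"
        by (rule closed_subrep_closure_Union_chain[OF False mem(1) total])
      moreover have "cosine_bound H K \<epsilon> (closure (\<Union>C))"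
        by (rule cosine_bound_closure_Union_chain[OF H K \<open>0 \<le> \<epsilon>\<close> mem total])
      ultimately have "closure (\<Union>C) \<in> \<A>" by (simp add: \<A>_def)
      then show ?thesis using closure_subset[of "\<Union>C"] by blast
    qed (use \<open>{0} \<in> \<A>\<close> in blast)
  qed
  then obtain M where M: "closed_subrep M" "cosine_bound H K \<epsilon> M"
    and maximal: "\<And>S. closed_subrep S \<Longrightarrow> cosine_bound H K \<epsilon> S \<Longrightarrow> M \<subseteq> S \<Longrightarrow> S = M"
    unfolding \<A>_def by blast
  have "M\<^sup>\<bottom> = {0}"
  proof (rule ccontr)
    assume "M\<^sup>\<bottom> \<noteq> {0}"
    then obtain T where T: "T \<subseteq> M\<^sup>\<bottom>" "closed_subrep T" "T \<noteq> {0}" "cosine_bound H K \<epsilon> T"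
      using piece closed_subrep_orthogonal_comp[OF M(1)] by blast
    let ?S = "(M\<^sup>\<bottom> \<inter> T\<^sup>\<bottom>)\<^sup>\<bottom>"
    have "closed_subrep ?S"
      using M T by (intro closed_subrep_orthogonal_comp closed_subrep_Int)
    moreover have "cosine_bound H K \<epsilon> ?S"
      using M T by (intro cosine_bound_orthogonal_sum H K \<open>0 \<le> \<epsilon>\<close>)
    moreover have "M \<subseteq> ?S" "T \<subseteq> ?S"
      by (auto simp: orthogonal_comp_def orthogonal_commute)
    ultimately have "T \<subseteq> M" using maximal by blast
    then have "orthogonal t t" if "t \<in> T" for t
      using T(1) that by (auto simp: orthogonal_comp_def subset_iff)
    then have "t = 0" if "t \<in> T" for t
      using that by (simp add: orthogonal_self)
    moreover have "0 \<in> T" using T(2) subspace_0 by (auto simp: closed_subrep_def)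
    ultimately show False using T(3) by blast
  qed
  moreover have "v - proj M v \<in> M\<^sup>\<bottom>" "proj M v \<in> M" for v
    using M(1) proj_residual proj_mem by (auto simp: closed_subrep_def)
  ultimately have "M = UNIV" by (metis UNIV_eq_I eq_iff_diff_eq_0 singletonD)
  then show ?thesis using M(2) by simp
qed

end

section \<open>The commutator pairing in a group of class two\<close>

text \<open>
  For \<open>c = [a, b]\<close> the commutator \<open>[c, g]\<close> lies in the third term of the lower central series,
  which is trivial.
\<close>

lemma (in group) class_two_commutator_central:
  assumes "has_nilpotency_class G 2" "a \<in> carrier G" "b \<in> carrier G" "g \<in> carrier G"
  shows "commutator G a b \<otimes> g = g \<otimes> commutator G a b"
proof -
  let ?c = "commutator G a b"
  have c: "?c \<in> carrier G" using assms by (simp add: commutator_def)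
  have "?c \<in> lower_central G 1" using assms by (auto intro: generate.incl)
  then have "commutator G ?c g \<in> lower_central G 2"
    using assms by (auto simp: numeral_2_eq_2 intro: generate.incl)
  then have "?c \<otimes> g \<otimes> inv ?c \<otimes> inv g = \<one>"
    using assms(1) by (simp add: has_nilpotency_class_def commutator_def)
  then have "?c \<otimes> g \<otimes> inv (g \<otimes> ?c) = \<one>"
    using c assms by (simp add: inv_mult_group m_assoc)
  then show ?thesis using c assms by (metis inv_equality inv_inv inv_closed m_closed)
qed

text \<open>
  One representative from each of \<open>n\<close> cosets. The formulation also covers infinite index, where
  \<open>n\<close> is arbitrary.
\<close>

lemma (in group) incongruent_elements_exist:
  assumes N: "subgroup N G" and n: "enat n \<le> subgroup_index G N"
  shows "\<exists>R\<subseteq>carrier G. finite R \<and> card R = n \<and> (\<forall>a\<in>R. \<forall>b\<in>R. a \<noteq> b \<longrightarrow> a \<otimes> inv b \<notin> N)"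
proof -
  have "\<exists>C\<subseteq>rcosets N. finite C \<and> card C = n"
  proof (cases "finite (rcosets N)")
    case True
    then have "n \<le> card (rcosets N)" using n by (simp add: subgroup_index_def)
    then show ?thesis by (metis obtain_subset_with_card_n)
  next
    case False
    then show ?thesis by (metis infinite_arbitrarily_large)
  qed
  then obtain C where C: "C \<subseteq> rcosets N" "finite C" "card C = n" by blast
  have "\<exists>a. a \<in> carrier G \<and> c = N #> a" if "c \<in> C" for c
    using that C(1) by (auto simp: RCOSETS_def)
  then obtain f where f: "\<And>c. c \<in> C \<Longrightarrow> f c \<in> carrier G \<and> c = N #> f c" by metis
  have "inj_on f C" using f by (metis inj_onI)
  moreover have "f c \<otimes> inv (f d) \<notin> N" if "c \<in> C" "d \<in> C" "f c \<noteq> f d" for c d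
  proof
    assume "f c \<otimes> inv (f d) \<in> N"
    then have "f c \<in> N #> f d"
      using subgroup.rcos_module_rev[OF N is_group] f that by blast
    then have "N #> f d = N #> f c" using repr_independence N f that by blast
    then have "c = d" using f that by metis
    then show False using that by simp
  qed
  ultimately show ?thesis
    using C f by (intro exI[of _ "f ` C"]) (auto simp: card_image)
qed

text \<open>
  Centrality of the commutators makes \<open>(x, y) \<mapsto> [x, y]\<close> a biadditive pairing; for each vector
  \<open>v\<close>, the representation turns it into a pairing modulo the stabilizer of \<open>v\<close>.
\<close>

locale central_pairing_rep = orthogonal_rep G \<rho>
  for G :: "('g, 'b) monoid_scheme" (structure)
    and \<rho> :: "'g \<Rightarrow> 'v::{real_inner,complete_space} \<Rightarrow> 'v" +
  fixes X Y :: "'g set"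
  assumes X: "subgroup X G" and Y: "subgroup Y G"
    and generated: "generate G (X \<union> Y) = carrier G"
    and central: "\<lbrakk>x \<in> X; y \<in> Y; g \<in> carrier G\<rbrakk> \<Longrightarrow>
      commutator G x y \<otimes> g = g \<otimes> commutator G x y"
begin

lemma X_carrier: "x \<in> X \<Longrightarrow> x \<in> carrier G" and Y_carrier: "y \<in> Y \<Longrightarrow> y \<in> carrier G"
  using X Y subgroup.mem_carrier by metis+

lemma X_sub: "X \<subseteq> carrier G" and Y_sub: "Y \<subseteq> carrier G"
  using X Y subgroup.subset by blast+

lemma commutator_carrier: "x \<in> X \<Longrightarrow> y \<in> Y \<Longrightarrow> commutator G x y \<in> carrier G"
  by (simp add: commutator_def X_carrier Y_carrier)

lemma commutator_swap: "x \<in> X \<Longrightarrow> y \<in> Y \<Longrightarrow> x \<otimes> y = commutator G x y \<otimes> (y \<otimes> x)"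
  by (simp add: commutator_def X_carrier Y_carrier m_assoc inv_solve_left')

lemma commutator_mult_left:
  assumes "x \<in> X" "x' \<in> X" "y \<in> Y"
  shows "commutator G (x \<otimes> x') y = commutator G x y \<otimes> commutator G x' y"
proof -
  note c = X_carrier[OF assms(1)] X_carrier[OF assms(2)] Y_carrier[OF assms(3)]
    commutator_carrier[OF assms(2,3)]
  have cancel: "inv y \<otimes> (y \<otimes> g) = g" if "g \<in> carrier G" for g
    using c that by (simp flip: m_assoc)
  have "commutator G (x \<otimes> x') y = x \<otimes> commutator G x' y \<otimes> (y \<otimes> inv x \<otimes> inv y)"
    using c by (simp add: commutator_def[of G "x \<otimes> x'"] commutator_def[of G x'] m_assoc
        inv_mult_group cancel)
  also have "\<dots> = x \<otimes> (commutator G x' y \<otimes> (y \<otimes> inv x \<otimes> inv y))"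
    using c by (simp add: m_assoc)
  also have "\<dots> = x \<otimes> ((y \<otimes> inv x \<otimes> inv y) \<otimes> commutator G x' y)"
    using c by (simp add: central[OF assms(2,3)])
  also have "\<dots> = commutator G x y \<otimes> commutator G x' y"
    using c by (simp add: commutator_def[of G x y] m_assoc)
  finally show ?thesis .
qed

lemma commutator_one_left: "y \<in> Y \<Longrightarrow> commutator G \<one> y = \<one>"
  by (simp add: commutator_def Y_carrier)

lemma rho_central:
  "x \<in> X \<Longrightarrow> y \<in> Y \<Longrightarrow> g \<in> carrier G \<Longrightarrow>
    \<rho> (commutator G x y) (\<rho> g v) = \<rho> g (\<rho> (commutator G x y) v)"
  using rho_mult commutator_carrier central by metis

definition radical :: "'v \<Rightarrow> 'g set" where
  "radical v = {x \<in> X. \<forall>y\<in>Y. \<rho> (commutator G x y) v = v}"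

lemma radical_subgroup: "subgroup (radical v) (G\<lparr>carrier := X\<rparr>)"
proof
  show "radical v \<subseteq> carrier (G\<lparr>carrier := X\<rparr>)" by (auto simp: radical_def)
  show "a \<otimes>\<^bsub>G\<lparr>carrier := X\<rparr>\<^esub> b \<in> radical v" if "a \<in> radical v" "b \<in> radical v" for a b
    using that X by (auto simp: radical_def commutator_mult_left rho_mult commutator_carrier
        subgroup.m_closed)
  show "\<one>\<^bsub>G\<lparr>carrier := X\<rparr>\<^esub> \<in> radical v"
    using X by (auto simp: radical_def commutator_one_left rho_one subgroup.one_closed)
  show "inv\<^bsub>G\<lparr>carrier := X\<rparr>\<^esub> a \<in> radical v" if a: "a \<in> radical v" for a
  proof -
    have aX: "a \<in> X" "inv a \<in> X" using a X by (auto simp: radical_def subgroup.m_inv_closed)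
    have "\<rho> (commutator G (inv a) y) v = v" if y: "y \<in> Y" for y
    proof -
      have "commutator G (inv a) y \<otimes> commutator G a y = \<one>"
        using commutator_mult_left[OF aX(2,1) y] aX y by (simp add: X_carrier commutator_one_left)
      then have "\<rho> (commutator G (inv a) y) (\<rho> (commutator G a y) v) = v"
        using aX y by (simp flip: rho_mult add: commutator_carrier rho_one)
      then show ?thesis using a y by (simp add: radical_def)
    qed
    then show ?thesis using aX X by (simp add: radical_def m_inv_consistent)
  qed
qed

text \<open>
  The balance condition moves a scalar from \<open>x\<close> to \<open>y\<close>: if \<open>[x, y]\<close> fixes
  \<open>v\<close> for every \<open>y\<close>, then so does \<open>[xr, y] = [x, ry]\<close>, because \<open>ry \<in> Y\<close>.
\<close>

lemma radical_right_submodule: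
  assumes "A_group A G X Y ract lact"
  shows "right_submodule A (G\<lparr>carrier := X\<rparr>) ract (radical v)"
proof -
  have "right_module A (G\<lparr>carrier := X\<rparr>) ract" "left_module A (G\<lparr>carrier := Y\<rparr>) lact"
    using assms by (auto simp: A_group_def)
  then have "ract x r \<in> X" "lact r y \<in> Y" if "x \<in> X" "y \<in> Y" "r \<in> carrier A" for x y r
    using that right_module.act_closed left_module.act_closed by fastforce+
  moreover have "commutator G (ract x r) y = commutator G x (lact r y)"
    if "x \<in> X" "y \<in> Y" "r \<in> carrier A" for x y r
    using assms that by (auto simp: A_group_def)
  moreover have "Y \<noteq> {}" using Y subgroup.one_closed by blast
  ultimately show ?thesis
    by (auto simp: right_submodule_def radical_subgroup) (auto simp: radical_def)
qed

lemma closed_subrep_invariants_central: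
  assumes "Z \<subseteq> {commutator G x y |x y. x \<in> X \<and> y \<in> Y}"
  shows "closed_subrep (invariants \<rho> Z)"
proof -
  have Z: "z \<in> carrier G \<and> (\<forall>g\<in>carrier G. \<forall>v. \<rho> z (\<rho> g v) = \<rho> g (\<rho> z v))" if "z \<in> Z" for z
    using that assms rho_central commutator_carrier by blast
  then have "Z \<subseteq> carrier G" by blast
  moreover have "\<rho> g v \<in> invariants \<rho> Z" if g: "g \<in> carrier G" and v: "v \<in> invariants \<rho> Z" for g v
  proof -
    have "\<rho> z (\<rho> g v) = \<rho> g (\<rho> z v)" "\<rho> z v = v" if "z \<in> Z" for z
      using Z[OF that] g v that by (auto simp: invariants_def)
    then show ?thesis by (simp add: invariants_def)
  qed
  ultimately show ?thesis
    by (simp add: closed_subrep_def subspace_invariants closed_invariants image_subset_iff)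
qed

definition isotypic :: "'g set \<Rightarrow> 'v set \<Rightarrow> bool" where
  "isotypic N T \<longleftrightarrow> closed_subrep T \<and> (\<forall>v\<in>T. v \<noteq> 0 \<longrightarrow> radical v = N)"

text \<open>
  A chain of vectors of \<open>R\<close> with strictly increasing radicals would contradict the chain condition, so
  some nonzero \<open>v \<in> R\<close> has a maximal radical. The vectors of \<open>R\<close> fixed by all
  \<open>[x, y]\<close> with \<open>x \<in> radical v\<close> form a closed subspace, invariant since these commutators are
  central. All its nonzero vectors have radicals containing, hence equal to, that of \<open>v\<close>.
\<close>

lemma isotypic_exists:
  assumes R: "closed_subrep R" "R \<noteq> {0}"
    and acc: "ascending_chain_condition P" "\<And>v. P (radical v)"
  shows "\<exists>v. \<exists>T\<subseteq>R. T \<noteq> {0} \<and> isotypic (radical v) T"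
proof -
  have "0 \<in> R" using R(1) subspace_0 by (auto simp: closed_subrep_def)
  have "\<exists>v\<in>R - {0}. \<forall>s\<in>R - {0}. radical v \<subseteq> radical s \<longrightarrow> radical s = radical v"
  proof (rule ccontr)
    assume "\<not> ?thesis"
    then have "\<forall>v\<in>R - {0}. \<exists>s\<in>R - {0}. radical v \<subset> radical s" by blast
    then obtain f where f: "\<And>v. v \<in> R - {0} \<Longrightarrow> f v \<in> R - {0} \<and> radical v \<subset> radical (f v)"
      by metis
    obtain v where "v \<in> R - {0}" using R(2) \<open>0 \<in> R\<close> by blast
    then have it: "(f ^^ i) v \<in> R - {0}" for i
      by (induction i) (use f in simp_all)
    have strict: "radical ((f ^^ i) v) \<subset> radical ((f ^^ Suc i) v)" for i
      using f[OF it[of i]] by simp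
    then have "\<forall>i. P (radical ((f ^^ i) v)) \<and> radical ((f ^^ i) v) \<subseteq> radical ((f ^^ Suc i) v)"
      using acc(2) by blast
    then obtain k where "\<forall>i\<ge>k. radical ((f ^^ i) v) = radical ((f ^^ k) v)"
      using acc(1)[unfolded ascending_chain_condition_def, rule_format,
          of "\<lambda>i. radical ((f ^^ i) v)"] by blast
    then have "radical ((f ^^ Suc k) v) = radical ((f ^^ k) v)" using le_SucI by blast
    then show False using strict[of k] by blast
  qed
  then obtain v where v: "v \<in> R" "v \<noteq> 0"
    and maximal: "\<And>s. s \<in> R \<Longrightarrow> s \<noteq> 0 \<Longrightarrow> radical v \<subseteq> radical s \<Longrightarrow> radical s = radical v"
    by blast
  define Z where "Z = {commutator G x y |x y. x \<in> radical v \<and> y \<in> Y}"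
  define T where "T = R \<inter> invariants \<rho> Z"
  have "Z \<subseteq> {commutator G x y |x y. x \<in> X \<and> y \<in> Y}" by (auto simp: Z_def radical_def)
  then have "closed_subrep T"
    unfolding T_def by (intro closed_subrep_Int R(1) closed_subrep_invariants_central)
  moreover have "radical s = radical v" if s: "s \<in> T" "s \<noteq> 0" for s
  proof -
    have "x \<in> radical s" if x: "x \<in> radical v" for x
    proof -
      have "\<rho> (commutator G x y) s = s" if "y \<in> Y" for y
        using s(1) x that by (auto simp: T_def Z_def invariants_def)
      then show ?thesis using x by (simp add: radical_def)
    qed
    then show ?thesis using maximal s by (auto simp: T_def)
  qed
  moreover have "v \<in> T" using v by (auto simp: T_def Z_def invariants_def radical_def)
  ultimately have "isotypic (radical v) T" "T \<noteq> {0}"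
    unfolding isotypic_def using v(2) by blast+
  moreover have "T \<subseteq> R" by (simp add: T_def)
  ultimately show ?thesis by blast
qed

text \<open>
  The projection \<open>p\<close> of \<open>xw\<close> to the \<open>Y\<close>-fixed vectors of \<open>T\<close> does not change
  when \<open>xw = xyw = [x, y]yxw\<close> is rewritten in this way. As \<open>y\<close> acts trivially on \<open>p\<close>,
  this says that \<open>[x, y]\<close> fixes \<open>p\<close>, for every \<open>y\<close>. So \<open>x\<close> lies in the radical
  of \<open>p\<close>, which is impossible unless \<open>p = 0\<close>.
\<close>

lemma isotypic_translate_orthogonal:
  assumes T: "isotypic N T" and w: "w \<in> invariants \<rho> Y \<inter> T" and x: "x \<in> X" "x \<notin> N"
  shows "inner (\<rho> x w) w = 0"
proof -
  define S where "S = invariants \<rho> Y \<inter> T"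
  define p where "p = proj S (\<rho> x w)"
  have T': "subspace T" "closed T" "\<And>g v. g \<in> carrier G \<Longrightarrow> v \<in> T \<Longrightarrow> \<rho> g v \<in> T"
    using T by (auto simp: isotypic_def closed_subrep_def)
  have S: "subspace S" "closed S"
    using T' Y_sub by (auto simp: S_def subspace_inter subspace_invariants closed_invariants closed_Int)
  have "p \<in> S" unfolding p_def by (rule proj_mem[OF S])
  have "\<rho> (commutator G x y) p = p" if y: "y \<in> Y" for y
  proof -
    let ?z = "commutator G x y"
    have z: "?z \<in> carrier G" using x y by (simp add: commutator_carrier)
    have y': "inv y \<in> Y" using y Y by (simp add: subgroup.m_inv_closed)
    have yS: "\<rho> y ` S \<subseteq> S" "\<rho> (inv y) ` S \<subseteq> S"
      using y y' by (auto simp: S_def invariants_def)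
    have comm: "\<rho> ?z (\<rho> g v) = \<rho> g (\<rho> ?z v)" if "g \<in> carrier G" for g v
      using rho_central x y that by blast
    have comm': "\<rho> (inv ?z) (\<rho> g v) = \<rho> g (\<rho> (inv ?z) v)" if "g \<in> carrier G" for g v
      using comm[OF that, of "\<rho> (inv ?z) v"] z by (metis rho_inv)
    have zS: "\<rho> ?z ` S \<subseteq> S" "\<rho> (inv ?z) ` S \<subseteq> S"
      using z T'(3) comm[OF Y_carrier, symmetric] comm'[OF Y_carrier, symmetric]
      by (auto simp: S_def invariants_def)
    have "\<rho> x w = \<rho> (x \<otimes> y) w"
      using x y w by (simp add: rho_mult X_carrier Y_carrier invariants_def)
    also have "\<dots> = \<rho> ?z (\<rho> y (\<rho> x w))"
      using x y z by (simp add: commutator_swap rho_mult X_carrier Y_carrier)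
    finally have "p = proj S (\<rho> ?z (\<rho> y (\<rho> x w)))" by (simp add: p_def)
    also have "\<dots> = \<rho> ?z (\<rho> y p)"
      using proj_rho[OF S z zS] proj_rho[OF S Y_carrier[OF y] yS] by (simp add: p_def)
    also have "\<rho> y p = p" using \<open>p \<in> S\<close> y by (simp add: S_def invariants_def)
    finally show ?thesis by simp
  qed
  then have "x \<in> radical p" using x by (simp add: radical_def)
  then have "p = 0" using T \<open>p \<in> S\<close> x(2) by (auto simp: isotypic_def S_def)
  then show ?thesis
    using inner_proj[OF S, of w "\<rho> x w"] w by (simp add: p_def S_def inner_commute)
qed

text \<open>
  Bessel's inequality, for the orthogonal translates of \<open>w\<close> by \<open>n\<close> elements in different
  cosets of \<open>N\<close>; all of these have the same inner product with \<open>u\<close>, since \<open>u\<close> is fixed by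
  \<open>X\<close>.
\<close>

lemma isotypic_cosine_bound:
  assumes T: "isotypic N T" and N: "subgroup N (G\<lparr>carrier := X\<rparr>)"
    and n: "enat n \<le> subgroup_index (G\<lparr>carrier := X\<rparr>) N"
    and u: "u \<in> invariants \<rho> X \<inter> T" and w: "w \<in> invariants \<rho> Y \<inter> T"
  shows "sqrt n * \<bar>inner u w\<bar> \<le> norm u * norm w"
proof (cases "n = 0")
  case False
  interpret GX: group "G\<lparr>carrier := X\<rparr>" by (rule subgroup.subgroup_is_group[OF X is_group])
  obtain R where R: "R \<subseteq> X" "finite R" "card R = n"
    and inc: "\<And>a b. a \<in> R \<Longrightarrow> b \<in> R \<Longrightarrow> a \<noteq> b \<Longrightarrow> a \<otimes> inv b \<notin> N"
    using GX.incongruent_elements_exist[OF N n] X by (auto simp: m_inv_consistent subset_iff)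
  have RX: "a \<in> X" "inv a \<in> X" "a \<in> carrier G" if "a \<in> R" for a
    using that R(1) X by (auto simp: X_carrier subgroup.m_inv_closed)
  \<comment> \<open>Translating by inverses turns \<open>a \<otimes> inv b \<notin> N\<close> into the condition for orthogonality, without reordering.\<close>
  let ?s = "\<Sum>a\<in>R. \<rho> (inv a) w"
  have "inner (\<rho> (inv a) w) (\<rho> (inv b) w) = 0" if "a \<in> R" "b \<in> R" "a \<noteq> b" for a b
  proof -
    have "inner (\<rho> (inv a) w) (\<rho> (inv b) w) = inner (\<rho> (b \<otimes> inv a) w) w"
      using inner_rho_adjoint[of "inv b" "\<rho> (inv a) w" w] RX that by (simp add: rho_mult)
    also have "\<dots> = 0"
      using RX that X inc
      by (intro isotypic_translate_orthogonal[OF T w]) (auto simp: subgroup.m_closed)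
    finally show ?thesis .
  qed
  then have "(norm ?s)\<^sup>2 = (\<Sum>a\<in>R. (norm (\<rho> (inv a) w))\<^sup>2)"
    by (intro norm_sum_Pythagorean R(2)) (auto simp: pairwise_def orthogonal_def)
  also have "\<dots> = (sqrt n * norm w)\<^sup>2"
    using R RX by (simp add: norm_rho power_mult_distrib)
  finally have s: "norm ?s = sqrt n * norm w"
    by (simp add: power2_eq_iff_nonneg)
  have "inner u (\<rho> (inv a) w) = inner u w" if "a \<in> R" for a
    using inner_rho_adjoint[of "inv a" u w] RX[OF that] u by (simp add: invariants_def)
  then have "inner u ?s = n * inner u w" using R(3) by (simp add: inner_sum_right)
  then have "n * \<bar>inner u w\<bar> \<le> norm u * (sqrt n * norm w)"
    using Cauchy_Schwarz_ineq2[of u ?s] s by (simp add: abs_mult)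
  then have "sqrt n * (sqrt n * \<bar>inner u w\<bar>) \<le> sqrt n * (norm u * norm w)"
    by (simp add: mult.assoc[symmetric]) (simp add: mult_ac)
  then show ?thesis using False by (simp add: mult_le_cancel_left_pos)
qed simp

lemma invariants_generated: "invariants \<rho> X \<inter> invariants \<rho> Y \<subseteq> invariants \<rho> (carrier G)"
proof
  fix v assume v: "v \<in> invariants \<rho> X \<inter> invariants \<rho> Y"
  have fixed: "h \<in> carrier G \<and> \<rho> h v = v" if "h \<in> X \<union> Y" for h
    using that v X_carrier Y_carrier by (auto simp: invariants_def)
  have "g \<in> carrier G \<and> \<rho> g v = v" if "g \<in> generate G (X \<union> Y)" for g
    using that
  proof induction
    case (inv h) then show ?case using fixed by (metis inv_closed rho_inv(1))
  qed (use fixed in \<open>auto simp: rho_one rho_mult\<close>)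
  then show "v \<in> invariants \<rho> (carrier G)" by (simp add: generated invariants_def)
qed

text \<open>
  On \<open>T\<close> the commutators act trivially, so \<open>X\<close> preserves the space of \<open>Y\<close>-fixed vectors, and
  projecting the \<open>X\<close>-fixed vector \<open>u\<close> to these gives a vector fixed by both \<open>X\<close> and
  \<open>Y\<close>.
\<close>

lemma isotypic_trivial_orthogonal:
  assumes T: "isotypic X T" and no_invariants: "invariants \<rho> (carrier G) = {0}"
    and u: "u \<in> invariants \<rho> X \<inter> T" and w: "w \<in> invariants \<rho> Y \<inter> T"
  shows "inner u w = 0"
proof -
  define S where "S = invariants \<rho> Y \<inter> T"
  have T': "subspace T" "closed T" "\<And>g v. g \<in> carrier G \<Longrightarrow> v \<in> T \<Longrightarrow> \<rho> g v \<in> T"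
    using T by (auto simp: isotypic_def closed_subrep_def)
  have S: "subspace S" "closed S"
    using T' Y_sub by (auto simp: S_def subspace_inter subspace_invariants closed_invariants closed_Int)
  have xS: "\<rho> x ` S \<subseteq> S" if x: "x \<in> X" for x
  proof -
    have "\<rho> y (\<rho> x s) = \<rho> x s" if s: "s \<in> S" and y: "y \<in> Y" for s y
    proof -
      let ?z = "commutator G x y"
      have c: "x \<in> carrier G" "y \<in> carrier G" "?z \<in> carrier G"
        using x y by (simp_all add: X_carrier Y_carrier commutator_carrier)
      have "\<rho> ?z s = s"
      proof (cases "s = 0")
        case True
        then show ?thesis using rho_linear[OF c(3)] by (simp add: linear_0)
      next
        case False
        then have "x \<in> radical s" using T s x by (auto simp: isotypic_def S_def)
        then show ?thesis using y by (simp add: radical_def)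
      qed
      have "\<rho> x s = \<rho> (x \<otimes> y) s" using c s y by (simp add: rho_mult S_def invariants_def)
      also have "\<dots> = \<rho> ?z (\<rho> y (\<rho> x s))"
        using x y c by (simp add: commutator_swap rho_mult)
      also have "\<dots> = \<rho> y (\<rho> x (\<rho> ?z s))"
        using x y c rho_central by simp
      finally show ?thesis using \<open>\<rho> ?z s = s\<close> by simp
    qed
    then show ?thesis using T'(3) X_carrier[OF x] by (auto simp: S_def invariants_def)
  qed
  have "\<rho> x (proj S u) = proj S u" if x: "x \<in> X" for x
  proof -
    have "inv x \<in> X" using x X by (simp add: subgroup.m_inv_closed)
    then have "\<rho> x (proj S u) = proj S (\<rho> x u)"
      using proj_rho[OF S X_carrier[OF x] xS[OF x] xS] by simp
    then show ?thesis using u x by (simp add: invariants_def)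
  qed
  then have "proj S u \<in> invariants \<rho> X \<inter> invariants \<rho> Y"
    using proj_mem[OF S, of u] by (auto simp: S_def invariants_def)
  then have "proj S u = 0" using invariants_generated no_invariants by blast
  then show ?thesis using inner_proj[OF S, of w u] w by (simp add: S_def inner_commute)
qed

end

section \<open>Orthogonality of the generating subgroups\<close>

lemma inverse_sqrt_nonneg: "0 \<le> inverse_sqrt m"
  by (simp add: inverse_sqrt_def split: enat.split)

text \<open>
  Stating the bound through all finite \<open>n \<le> m\<close> treats finite and infinite \<open>m\<close> alike. The value
  \<open>m = 0\<close> is excluded because \<open>inverse_sqrt 0 = 1 / 0 = 0\<close>.
\<close>

lemma le_inverse_sqrt_mult:
  assumes "m \<noteq> 0" "0 \<le> a" and le: "\<And>n. enat n \<le> m \<Longrightarrow> sqrt n * a \<le> b"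
  shows "a \<le> inverse_sqrt m * b"
proof (cases m)
  case (enat k)
  then have "k > 0" using assms(1) by (simp add: zero_enat_def)
  then show ?thesis using le[of k] enat by (simp add: inverse_sqrt_def field_simps)
next
  case infinity
  have "a = 0"
  proof (rule ccontr)
    assume "a \<noteq> 0"
    then have "a > 0" using assms(2) by simp
    obtain n :: nat where n: "(b / a)\<^sup>2 < n" using reals_Archimedean2 by blast
    have "b / a < sqrt n" using n by (rule real_less_rsqrt)
    then have "b < sqrt n * a" using \<open>a > 0\<close> by (simp add: field_simps)
    then show False using le[of n] infinity by simp
  qed
  then show ?thesis using infinity by (simp add: inverse_sqrt_def)
qed

lemma (in group) subgroup_index_pos: "1 \<le> subgroup_index G N"
proof -
  have "rcosets N \<noteq> {}" by (auto simp: RCOSETS_def)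
  then show ?thesis
    by (simp add: subgroup_index_def one_enat_def Suc_le_eq card_gt_0_iff)
qed

lemma cinner_scaleC_right: "cinner x (a *\<^sub>C y) = cnj a * cinner x y"
  for x y :: "'v::complex_inner"
  by (metis cinner_commute cinner_scaleC_left complex_cnj_mult)

lemma norm_scaleC: "norm (a *\<^sub>C x) = cmod a * norm x" for x :: "'v::complex_inner"
proof -
  have "complex_of_real ((norm (a *\<^sub>C x))\<^sup>2) = (a * cnj a) * cinner x x"
    by (simp only: cinner_self[of "a *\<^sub>C x", symmetric] cinner_scaleC_left cinner_scaleC_right mult_ac)
  also have "\<dots> = complex_of_real ((cmod a * norm x)\<^sup>2)"
    by (simp only: complex_norm_square[symmetric] cinner_self power_mult_distrib of_real_mult)
  finally have "complex_of_real ((norm (a *\<^sub>C x))\<^sup>2) = complex_of_real ((cmod a * norm x)\<^sup>2)" .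
  then have "(norm (a *\<^sub>C x))\<^sup>2 = (cmod a * norm x)\<^sup>2" by (simp only: of_real_eq_iff)
  then show ?thesis by (simp add: power2_eq_iff_nonneg)
qed

lemma unitary_rep_orthogonal_rep:
  assumes "group G" "unitary_rep G \<rho>"
  shows "orthogonal_rep G \<rho>"
proof -
  interpret group_hom G unitary_group \<rho>
    using assms group_unitary_group by (simp add: group_hom_def group_hom_axioms_def unitary_rep_def)
  have U: "unitary_op (\<rho> g)" if "g \<in> carrier G" for g
    using hom_closed[OF that] by (simp add: unitary_group_def)
  show ?thesis
  proof (intro orthogonal_rep.intro orthogonal_rep_axioms.intro assms(1))
    show "linear (\<rho> g)" if "g \<in> carrier G" for g
    proof (rule linearI)
      have add: "\<rho> g (x + y) = \<rho> g x + \<rho> g y" and scale: "\<rho> g (c *\<^sub>C x) = c *\<^sub>C \<rho> g x" for x y c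
        using U[OF that] unfolding unitary_op_def Vector_Spaces.linear_iff by blast+
      show "\<rho> g (x + y) = \<rho> g x + \<rho> g y" for x y by (rule add)
      show "\<rho> g (r *\<^sub>R x) = r *\<^sub>R \<rho> g x" for r x
        using scale[of "complex_of_real r" x] by (simp only: scaleC_of_real)
    qed
    show "\<rho> (g \<otimes>\<^bsub>G\<^esub> h) v = \<rho> g (\<rho> h v)" if "g \<in> carrier G" "h \<in> carrier G" for g h v
      using hom_mult[OF that] by (simp add: unitary_group_def)
    show "\<rho> \<one>\<^bsub>G\<^esub> v = v" for v
      using hom_one by (simp add: unitary_group_def)
    show "inner (\<rho> g v) (\<rho> g w) = inner v w" if "g \<in> carrier G" for g v w
      using U[OF that] by (simp add: inner_eq_Re_cinner unitary_op_def)
  qed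
qed

theorem corollary4p7:
  fixes G :: "('g, 'b) monoid_scheme" and X Y :: "'g set"
    and A :: "('r, 'c) ring_scheme"
    and ract :: "'g \<Rightarrow> 'r \<Rightarrow> 'g" and lact :: "'r \<Rightarrow> 'g \<Rightarrow> 'g"
    and m :: enat
  assumes "group G"
    and "has_nilpotency_class G 2"
    and "subgroup X G" and "comm_group (G\<lparr>carrier := X\<rparr>)"
    and "subgroup Y G" and "comm_group (G\<lparr>carrier := Y\<rparr>)"
    and "generate G (X \<union> Y) = carrier G"
    and "ring A"
    and "noetherian_A_group A G X Y ract lact"
    and "m = min_right_submodule_index A (G\<lparr>carrier := X\<rparr>) ract"
  shows "eps_orthogonal TYPE('v::chilbert_space) G X Y (inverse_sqrt m)"
  unfolding eps_orthogonal_def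
proof (intro allI impI ballI)
  fix \<rho> :: "'g \<Rightarrow> 'v \<Rightarrow> 'v" and u w
  assume "unitary_rep G \<rho> \<and> invariants \<rho> (carrier G) = {0}"
  then have rep: "unitary_rep G \<rho>" and no_invariants: "invariants \<rho> (carrier G) = {0}" by auto
  assume u: "u \<in> invariants \<rho> X" and w: "w \<in> invariants \<rho> Y"
  interpret group G by (rule assms(1))
  interpret orthogonal_rep G \<rho> by (rule unitary_rep_orthogonal_rep[OF assms(1) rep])
  interpret central_pairing_rep G \<rho> X Y
  proof (intro central_pairing_rep.intro central_pairing_rep_axioms.intro)
    show "orthogonal_rep G \<rho>" by (rule orthogonal_rep_axioms)
    show "subgroup X G" "subgroup Y G" "generate G (X \<union> Y) = carrier G" by (fact assms)+
    show "commutator G x y \<otimes>\<^bsub>G\<^esub> g = g \<otimes>\<^bsub>G\<^esub> commutator G x y"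
      if "x \<in> X" "y \<in> Y" "g \<in> carrier G" for x y g
      using class_two_commutator_central[OF assms(2)] assms(3,5) that
      by (simp add: subgroup.mem_carrier)
  qed
  let ?X = "G\<lparr>carrier := X\<rparr>"
  let ?P = "right_submodule A ?X ract"
  have A: "A_group A G X Y ract lact" "ascending_chain_condition ?P"
    using assms(9) by (auto simp: noetherian_A_group_def)
  have m_le: "m \<le> subgroup_index ?X N" if "?P N" "N \<noteq> X" for N
    unfolding assms(10) min_right_submodule_index_def using that by (intro Inf_lower) auto
  have "1 \<le> m"
    unfolding assms(10) min_right_submodule_index_def
    using group.subgroup_index_pos[OF subgroup.subgroup_is_group[OF assms(3,1)]]
    by (intro Inf_greatest) auto
  then have "m \<noteq> 0" by auto
  have "cosine_bound X Y (inverse_sqrt m) UNIV"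
  proof (rule cosine_bound_exhaustion[OF X_sub Y_sub inverse_sqrt_nonneg])
    fix R assume R: "closed_subrep R" "R \<noteq> {0}"
    obtain v T where T: "T \<subseteq> R" "T \<noteq> {0}" "isotypic (radical v) T"
      using isotypic_exists[OF R A(2)] radical_right_submodule[OF A(1)] by blast
    have "cosine_bound X Y (inverse_sqrt m) T"
      unfolding cosine_bound_def
    proof (intro ballI)
      fix u w assume uw: "u \<in> invariants \<rho> X \<inter> T" "w \<in> invariants \<rho> Y \<inter> T"
      show "\<bar>inner u w\<bar> \<le> inverse_sqrt m * norm u * norm w"
      proof (cases "radical v = X")
        case True
        then have "inner u w = 0"
          using isotypic_trivial_orthogonal T(3) no_invariants uw by simp
        then show ?thesis by (simp add: inverse_sqrt_nonneg)
      next
        case False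
        have "sqrt n * \<bar>inner u w\<bar> \<le> norm u * norm w" if "enat n \<le> m" for n
          using isotypic_cosine_bound[OF T(3) radical_subgroup _ uw] that
            m_le[OF radical_right_submodule[OF A(1)] False] order_trans by blast
        then have "\<bar>inner u w\<bar> \<le> inverse_sqrt m * (norm u * norm w)"
          by (rule le_inverse_sqrt_mult[OF \<open>m \<noteq> 0\<close> abs_ge_zero])
        then show ?thesis by (simp only: mult.assoc)
      qed
    qed
    then show "\<exists>T\<subseteq>R. closed_subrep T \<and> T \<noteq> {0} \<and> cosine_bound X Y (inverse_sqrt m) T"
      using T by (auto simp: isotypic_def)
  qed
  then have bound: "\<bar>inner u' w\<bar> \<le> inverse_sqrt m * norm u' * norm w" if "u' \<in> invariants \<rho> X" for u'
    using that w by (simp add: cosine_bound_def)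
  show "cmod (cinner u w) \<le> inverse_sqrt m * norm u * norm w"
  proof (cases "cinner u w = 0")
    case True
    then show ?thesis by (simp add: inverse_sqrt_nonneg)
  next
    case False
    \<comment> \<open>The phase that makes \<open>cinner (a *\<^sub>C u) w\<close> real and nonnegative, so that it equals \<open>inner\<close>.\<close>
    define a where "a = cnj (cinner u w) / cmod (cinner u w)"
    have "\<rho> x (a *\<^sub>C u) = a *\<^sub>C u" if "x \<in> X" for x
    proof -
      have "\<rho> x \<in> carrier unitary_group"
        using rep X_carrier[OF that] by (auto simp: unitary_rep_def hom_def)
      then show ?thesis
        using u that by (simp add: unitary_group_def unitary_op_def Vector_Spaces.linear_iff
            invariants_def)
    qed
    then have "a *\<^sub>C u \<in> invariants \<rho> X" by (simp add: invariants_def)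
    moreover have "norm (a *\<^sub>C u) = norm u"
      using False by (simp add: norm_scaleC a_def norm_divide)
    moreover have "a * cinner u w = complex_of_real (cmod (cinner u w))"
      using False complex_norm_square[of "cinner u w"]
      by (simp add: a_def power2_eq_square field_simps)
    then have "inner (a *\<^sub>C u) w = cmod (cinner u w)"
      by (simp add: inner_eq_Re_cinner cinner_scaleC_left)
    ultimately show ?thesis using bound[of "a *\<^sub>C u"] by simp
  qed
qed

end
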